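(* Let $F\in\mathfrak{G}_2$ be a map whose linear part has determinant $1$ or $-1$. Then $F$ is the product (in $\mathfrak{G}_2$) of at most four reversible elements of $\mathfrak{G}_2$ and an involution in $\mathfrak{G}_2$.
   Context: $\mathfrak{G}_2$ is the group, under formal composition, of formally invertible formal power series self-maps of $\mathbb{C}^2$ without constant term (pairs of formal power series in $z_1,z_2$ with complex coefficients, zero constant term, and invertible linear part). An element $g$ of a group is reversible if there is $h$ in the group with $h^{-1}gh=g^{-1}$. An involution is an element $h$ with $h^2=\mathrm{id}$ (the identity is allowed). *)

theory Defs
  imports
    "HOL-Analysis.Determinants"
    "HOL-Algebra.Group"
    "HOL-Computational_Algebra.Formal_Power_Series"
begin

text \<open>Power series in two variables are iterated series: the outer variable is \<open>z\<^sub>1\<close>, the inner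
  one is \<open>z\<^sub>2\<close>.\<close>

type_synonym fps2 = "complex fps fps"

text \<open>Coefficient of \<open>z\<^sub>1\<^sup>i z\<^sub>2\<^sup>j\<close>.\<close>

definition coeff2 :: "fps2 \<Rightarrow> nat \<Rightarrow> nat \<Rightarrow> complex" where
  "coeff2 f i j = fps_nth (fps_nth f i) j"

definition Z1 :: fps2 where "Z1 = fps_X"

definition Z2 :: fps2 where "Z2 = fps_const fps_X"

text \<open>Substitution \<open>f(g\<^sub>1, g\<^sub>2) = \<Sum> f\<^sub>i\<^sub>j g\<^sub>1\<^sup>i g\<^sub>2\<^sup>j\<close>.  As for \<open>fps_compose\<close>, this is meaningful only if
  \<open>g\<^sub>1\<close> and \<open>g\<^sub>2\<close> have no constant term: then \<open>g\<^sub>1\<^sup>i g\<^sub>2\<^sup>j\<close> has order at least \<open>i + j\<close>, so only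
  the terms with \<open>i + j \<le> m + n\<close> contribute to the coefficient of \<open>z\<^sub>1\<^sup>m z\<^sub>2\<^sup>n\<close>.\<close>

definition subst2 :: "fps2 \<Rightarrow> fps2 \<times> fps2 \<Rightarrow> fps2" where
  "subst2 f G = Abs_fps (\<lambda>m. Abs_fps (\<lambda>n.
     \<Sum>(i, j) \<in> {(i, j). i + j \<le> m + n}. coeff2 f i j * coeff2 (fst G ^ i * snd G ^ j) m n))"

definition comp2 :: "fps2 \<times> fps2 \<Rightarrow> fps2 \<times> fps2 \<Rightarrow> fps2 \<times> fps2" where
  "comp2 F G = (subst2 (fst F) G, subst2 (snd F) G)"

definition linear_part :: "fps2 \<times> fps2 \<Rightarrow> complex ^ 2 ^ 2" where
  "linear_part F = vector
     [vector [coeff2 (fst F) 1 0, coeff2 (fst F) 0 1],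
      vector [coeff2 (snd F) 1 0, coeff2 (snd F) 0 1]]"

definition G2 :: "(fps2 \<times> fps2) monoid" where
  "G2 = \<lparr>carrier = {F. coeff2 (fst F) 0 0 = 0 \<and> coeff2 (snd F) 0 0 = 0 \<and> invertible (linear_part F)},
         monoid.mult = comp2,
         one = (Z1, Z2)\<rparr>"

definition reversible :: "('a, 'b) monoid_scheme \<Rightarrow> 'a \<Rightarrow> bool" where
  "reversible G g \<longleftrightarrow> g \<in> carrier G \<and>
     (\<exists>h \<in> carrier G. inv\<^bsub>G\<^esub> h \<otimes>\<^bsub>G\<^esub> g \<otimes>\<^bsub>G\<^esub> h = inv\<^bsub>G\<^esub> g)"

text \<open>The identity counts as an involution.\<close>

definition involution :: "('a, 'b) monoid_scheme \<Rightarrow> 'a \<Rightarrow> bool" where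
  "involution G h \<longleftrightarrow> h \<in> carrier G \<and> h \<otimes>\<^bsub>G\<^esub> h = \<one>\<^bsub>G\<^esub>"

end

theory Submission imports Defs begin

text \<open>Multiplying by the linear involution \<open>diag(1, -1)\<close> if necessary, let the linear part of \<open>F\<close> have
  determinant 1.  Every linear map of determinant 1 is reversible, so after splitting off one linear
  reversible factor the linear part becomes \<open>diag(2, 1/2)\<close>.

  If \<open>H\<close> is an involution, then \<open>q (H q H)\<^sup>-\<^sup>1\<close> is reversible for every \<open>q\<close>, and so are its conjugates.
  Hence it suffices to solve \<open>F = (T\<^sup>-\<^sup>1 (S Q S)\<^sup>-\<^sup>1 Q T) (q (H q H)\<^sup>-\<^sup>1)\<close> with involutions \<open>S\<close> and \<open>H\<close>, that
  is, \<open>(S Q S) T F (H q H) = Q T q\<close>.  Degree by degree this is a linear system: \<open>T\<close>, tangent to the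
  identity, removes the nonresonant terms, as in the Poincare-Dulac normal form.  With \<open>S\<close> the swap,
  \<open>Q\<close> accounts for the resonant terms \<open>z\<^sub>1\<^sup>m\<^sup>+\<^sup>1 z\<^sub>2\<^sup>m\<close> of the first component.  The resonant terms
  \<open>z\<^sub>1\<^sup>m z\<^sub>2\<^sup>m\<^sup>+\<^sup>1\<close> of the second component are left to \<open>q\<close>, whose
  involution \<open>H\<close> must not be diagonal: \<open>q = (z\<^sub>1, z\<^sub>2 + \<Sum> s\<^sub>m z\<^sub>1 (z\<^sub>1 + z\<^sub>2)\<^sup>2\<^sup>m)\<close>, where \<open>H\<close> fixes
  \<open>z\<^sub>1\<close> and negates \<open>z\<^sub>1 + z\<^sub>2\<close>, contributes the nonzero binomial coefficient \<open>2m choose (m - 1)\<close>.\<close>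

section \<open>Coefficients and order\<close>

definition C2 :: "complex \<Rightarrow> fps2" where "C2 c = fps_const (fps_const c)"

definition Abs2 :: "(nat \<Rightarrow> nat \<Rightarrow> complex) \<Rightarrow> fps2" where
  "Abs2 a = Abs_fps (\<lambda>i. Abs_fps (a i))"

definition ordge :: "nat \<Rightarrow> fps2 \<Rightarrow> bool" where
  "ordge n f \<longleftrightarrow> (\<forall>i j. i + j < n \<longrightarrow> coeff2 f i j = 0)"

lemma coeff2_ext: "(\<And>i j. coeff2 f i j = coeff2 g i j) \<Longrightarrow> f = g"
  by (simp add: coeff2_def fps_eq_iff)

lemma coeff2_Abs2 [simp]: "coeff2 (Abs2 a) i j = a i j"
  by (simp add: coeff2_def Abs2_def)

lemma coeff2_0 [simp]: "coeff2 0 i j = 0"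
  by (simp add: coeff2_def)

lemma coeff2_add [simp]: "coeff2 (f + g) i j = coeff2 f i j + coeff2 g i j"
  by (simp add: coeff2_def)

lemma coeff2_diff [simp]: "coeff2 (f - g) i j = coeff2 f i j - coeff2 g i j"
  by (simp add: coeff2_def)

lemma coeff2_uminus [simp]: "coeff2 (- f) i j = - coeff2 f i j"
  by (simp add: coeff2_def)

lemma coeff2_sum: "coeff2 (sum f A) i j = (\<Sum>a\<in>A. coeff2 (f a) i j)"
  by (induction A rule: infinite_finite_induct) auto

lemma coeff2_C2_mult [simp]: "coeff2 (C2 c * f) i j = c * coeff2 f i j"
  by (simp add: coeff2_def C2_def)

lemma coeff2_1 [simp]: "coeff2 1 i j = (if i = 0 \<and> j = 0 then 1 else 0)"
  by (simp add: coeff2_def)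

lemma coeff2_C2: "coeff2 (C2 c) i j = (if i = 0 \<and> j = 0 then c else 0)"
  by (simp add: coeff2_def C2_def)

lemma coeff2_Z1_mult [simp]: "coeff2 (Z1 * f) i j = (if i = 0 then 0 else coeff2 f (i - 1) j)"
  by (simp add: coeff2_def Z1_def)

lemma coeff2_Z2_mult [simp]: "coeff2 (Z2 * f) i j = (if j = 0 then 0 else coeff2 f i (j - 1))"
  by (simp add: coeff2_def Z2_def)

lemma coeff2_Z1 [simp]: "coeff2 Z1 i j = (if i = 1 \<and> j = 0 then 1 else 0)"
  using coeff2_Z1_mult[of 1 i j] by (auto split: if_splits)

lemma coeff2_Z2 [simp]: "coeff2 Z2 i j = (if i = 0 \<and> j = 1 then 1 else 0)"
  using coeff2_Z2_mult[of 1 i j] by (auto split: if_splits)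

lemma coeff2_mult: "coeff2 (f * g) i j = (\<Sum>k\<le>i. \<Sum>l\<le>j. coeff2 f k l * coeff2 g (i - k) (j - l))"
  by (simp add: coeff2_def fps_mult_nth fps_sum_nth atLeast0AtMost)

lemma coeff2_monom: "coeff2 (Z1 ^ a * Z2 ^ b) i j = (if i = a \<and> j = b then 1 else 0)"
proof -
  have "coeff2 (Z2 ^ b) i j = (if i = 0 \<and> j = b then 1 else 0)" for i j
    by (induction b arbitrary: j) auto
  then show ?thesis
    by (induction a arbitrary: i) (auto simp: mult.assoc)
qed

lemma C2_power: "C2 c ^ n = C2 (c ^ n)"
  by (simp add: C2_def flip: fps_const_power)

lemma C2_0 [simp]: "C2 0 = 0" and C2_1 [simp]: "C2 1 = 1"
  by (simp_all add: C2_def)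

lemma ordge_add: "ordge n f \<Longrightarrow> ordge n g \<Longrightarrow> ordge n (f + g)"
  by (simp add: ordge_def)

lemma ordge_mono: "ordge n f \<Longrightarrow> m \<le> n \<Longrightarrow> ordge m f"
  by (simp add: ordge_def)

lemma ordge_mult:
  assumes "ordge m f" "ordge n g"
  shows "ordge (m + n) (f * g)"
  unfolding ordge_def
proof (intro allI impI)
  fix i j assume ij: "i + j < m + n"
  have "coeff2 f k l * coeff2 g (i - k) (j - l) = 0" if "k \<le> i" "l \<le> j" for k l
  proof (cases "k + l < m")
    case True
    then show ?thesis using assms by (simp add: ordge_def)
  next
    case False
    then have "(i - k) + (j - l) < n" using ij that by linarith
    then show ?thesis using assms by (simp add: ordge_def)
  qed
  then show "coeff2 (f * g) i j = 0"
    unfolding coeff2_mult by (intro sum.neutral ballI) auto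
qed

lemma ordge_0 [simp]: "ordge 0 f"
  by (simp add: ordge_def)

lemma ordge_1_iff: "ordge 1 f \<longleftrightarrow> coeff2 f 0 0 = 0"
  by (simp add: ordge_def)

lemma ordge_power: "ordge 1 f \<Longrightarrow> ordge i (f ^ i)"
proof (induction i)
  case (Suc i)
  then show ?case using ordge_mult[of 1 f i "f ^ i"] by simp
qed simp

lemma ordge_Z1 [simp]: "ordge (Suc 0) Z1" and ordge_Z2 [simp]: "ordge (Suc 0) Z2"
  by (simp_all add: ordge_def)

section \<open>Substitution\<close>

text \<open>The last condition is continuity for the order topology: such maps are determined by their
  values on monomials.\<close>

definition lincont :: "(fps2 \<Rightarrow> fps2) \<Rightarrow> bool" where
  "lincont \<Phi> \<longleftrightarrow> (\<forall>f g. \<Phi> (f + g) = \<Phi> f + \<Phi> g) \<and> (\<forall>c f. \<Phi> (C2 c * f) = C2 c * \<Phi> f) \<and>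
     (\<forall>n f. ordge n f \<longrightarrow> ordge n (\<Phi> f))"

lemma lincont_sum:
  assumes "lincont \<Phi>"
  shows "\<Phi> (sum h A) = (\<Sum>a\<in>A. \<Phi> (h a))"
proof -
  have "\<Phi> (C2 0 * 0) = C2 0 * \<Phi> 0" using assms unfolding lincont_def by blast
  then have z: "\<Phi> 0 = 0" by (simp add: C2_def)
  have add: "\<Phi> (f + g) = \<Phi> f + \<Phi> g" for f g using assms unfolding lincont_def by blast
  show ?thesis by (induction A rule: infinite_finite_induct) (auto simp: z add)
qed

text \<open>Up to degree \<open>i + j\<close> the series \<open>f\<close> agrees with a polynomial
  \<open>p\<close>. Linearity settles \<open>p\<close>, and the images of \<open>f - p\<close> have
  order above \<open>i + j\<close>.\<close>

lemma lincont_ext: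
  assumes \<Phi>: "lincont \<Phi>" and \<Psi>: "lincont \<Psi>"
    and eq: "\<And>i j. \<Phi> (Z1 ^ i * Z2 ^ j) = \<Psi> (Z1 ^ i * Z2 ^ j)"
  shows "\<Phi> f = \<Psi> f"
proof (rule coeff2_ext)
  fix i j :: nat
  define n where "n = i + j"
  define p where "p = (\<Sum>(a, b)\<in>{..n} \<times> {..n}. C2 (coeff2 f a b) * (Z1 ^ a * Z2 ^ b))"
  have "coeff2 p k l = coeff2 f k l" if "k \<le> n" "l \<le> n" for k l
  proof -
    have "coeff2 p k l = (\<Sum>x\<in>{..n} \<times> {..n}. if x = (k, l) then coeff2 f k l else 0)"
      unfolding p_def coeff2_sum
      by (rule sum.cong) (auto simp: coeff2_monom split: if_splits)
    then show ?thesis using that by simp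
  qed
  then have ord: "ordge (Suc n) (f - p)"
    by (simp add: ordge_def)
  have "\<Phi> p = \<Psi> p"
    unfolding p_def lincont_sum[OF \<Phi>] lincont_sum[OF \<Psi>]
    using \<Phi> \<Psi> eq by (intro sum.cong) (auto simp: lincont_def)
  moreover have "\<Phi> f = \<Phi> p + \<Phi> (f - p)" "\<Psi> f = \<Psi> p + \<Psi> (f - p)"
    using \<Phi> \<Psi> unfolding lincont_def by (metis add.commute diff_add_cancel)+
  moreover have "ordge (Suc n) (\<Phi> (f - p))" "ordge (Suc n) (\<Psi> (f - p))"
    using \<Phi> \<Psi> ord unfolding lincont_def by blast+
  ultimately show "coeff2 (\<Phi> f) i j = coeff2 (\<Psi> f) i j"
    by (simp add: ordge_def n_def)
qed

lemma finite_triangle: "finite {(i, j). i + j \<le> (N::nat)}"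
  by (rule finite_subset[of _ "{..N} \<times> {..N}"]) auto

lemma coeff2_subst2:
  "coeff2 (subst2 f G) m n =
     (\<Sum>(i, j) \<in> {(i, j). i + j \<le> m + n}. coeff2 f i j * coeff2 (fst G ^ i * snd G ^ j) m n)"
  by (simp add: coeff2_def subst2_def)

lemma subst2_add [simp]: "subst2 (f + g) G = subst2 f G + subst2 g G"
  by (rule coeff2_ext)
     (simp add: coeff2_subst2 algebra_simps sum.distrib case_prod_unfold)

lemma subst2_C2_mult [simp]: "subst2 (C2 c * f) G = C2 c * subst2 f G"
  by (rule coeff2_ext)
     (simp add: coeff2_subst2 mult.assoc sum_distrib_left case_prod_unfold)

lemma subst2_diff [simp]: "subst2 (f - g) G = subst2 f G - subst2 g G"
  by (metis add_diff_cancel_right' diff_add_cancel subst2_add)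

lemma ordge_subst2: "ordge n f \<Longrightarrow> ordge n (subst2 f G)"
  by (auto simp: ordge_def coeff2_subst2 intro!: sum.neutral)

lemma lincont_subst2: "lincont (\<lambda>f. subst2 f G)"
  by (simp add: lincont_def ordge_subst2)

definition zero_const :: "fps2 \<times> fps2 \<Rightarrow> bool" where
  "zero_const G \<longleftrightarrow> ordge 1 (fst G) \<and> ordge 1 (snd G)"

lemma ordge_monom:
  assumes "zero_const G"
  shows "ordge (i + j) (fst G ^ i * snd G ^ j)"
  using assms unfolding zero_const_def by (intro ordge_mult ordge_power) auto

lemma subst2_monom:
  assumes "zero_const G"
  shows "subst2 (Z1 ^ i * Z2 ^ j) G = fst G ^ i * snd G ^ j"
proof (rule coeff2_ext)
  fix m n
  have "coeff2 (subst2 (Z1 ^ i * Z2 ^ j) G) m n =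
      (\<Sum>x\<in>{(i, j). i + j \<le> m + n}. if x = (i, j) then coeff2 (fst G ^ i * snd G ^ j) m n else 0)"
    unfolding coeff2_subst2
    by (rule sum.cong) (auto simp: coeff2_monom split: if_splits)
  also have "\<dots> = coeff2 (fst G ^ i * snd G ^ j) m n"
    using ordge_monom[OF assms, of i j]
    by (auto simp: finite_triangle ordge_def)
  finally show "coeff2 (subst2 (Z1 ^ i * Z2 ^ j) G) m n = coeff2 (fst G ^ i * snd G ^ j) m n" .
qed

text \<open>Both sides are linear and continuous in each factor, so \<open>lincont_ext\<close>
  applies twice: to \<open>g\<close> while \<open>f\<close> is a monomial, then to
  \<open>f\<close>.\<close>

lemma subst2_mult:
  assumes "zero_const G"
  shows "subst2 (f * g) G = subst2 f G * subst2 g G"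
proof -
  have om: "ordge n (f * g)" if "ordge n f" for n f g
    using ordge_mult[OF that, of 0 g] by simp
  have lc1: "lincont (\<lambda>f. subst2 (f * g) G)" "lincont (\<lambda>f. subst2 f G * h)" for g h
    by (auto simp: lincont_def ordge_subst2 om distrib_right mult.assoc)
  have lc2: "lincont (\<lambda>f. subst2 (g * f) G)" "lincont (\<lambda>f. h * subst2 f G)" for g h
    using lc1(1)[of g] lc1(2)[of h] by (simp_all add: mult.commute)
  have monom: "subst2 (Z1 ^ i * Z2 ^ j * g) G = (fst G ^ i * snd G ^ j) * subst2 g G" for i j
  proof (rule lincont_ext[OF lc2(1)[of "Z1 ^ i * Z2 ^ j"] lc2(2)[of "fst G ^ i * snd G ^ j"]])
    fix k l
    have "a ^ i * b ^ j * (a ^ k * b ^ l) = a ^ (i + k) * b ^ (j + l)" for a b :: fps2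
      by (simp add: power_add mult_ac)
    then show "subst2 (Z1 ^ i * Z2 ^ j * (Z1 ^ k * Z2 ^ l)) G =
        fst G ^ i * snd G ^ j * subst2 (Z1 ^ k * Z2 ^ l) G"
      by (simp only: subst2_monom[OF assms])
  qed
  show ?thesis
    by (rule lincont_ext[OF lc1(1)[of g] lc1(2)[of "subst2 g G"]])
       (simp add: monom subst2_monom[OF assms])
qed

lemma subst2_1 [simp]: "zero_const G \<Longrightarrow> subst2 1 G = 1"
  using subst2_monom[of G 0 0] by simp

lemma subst2_C2 [simp]: "zero_const G \<Longrightarrow> subst2 (C2 c) G = C2 c"
  using subst2_C2_mult[of c 1 G] by simp

lemma subst2_Z1 [simp]: "zero_const G \<Longrightarrow> subst2 Z1 G = fst G"
  using subst2_monom[of G 1 0] by simp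

lemma subst2_Z2 [simp]: "zero_const G \<Longrightarrow> subst2 Z2 G = snd G"
  using subst2_monom[of G 0 1] by simp

lemma subst2_power: "zero_const G \<Longrightarrow> subst2 (f ^ n) G = subst2 f G ^ n"
  by (induction n) (auto simp: subst2_mult)

lemma zero_const_comp2 [simp]: "zero_const F \<Longrightarrow> zero_const (comp2 F G)"
  by (simp add: zero_const_def comp2_def ordge_subst2)

lemma subst2_comp2:
  assumes "zero_const G" "zero_const H"
  shows "subst2 (subst2 f G) H = subst2 f (comp2 G H)"
proof (rule lincont_ext[where \<Phi> = "\<lambda>f. subst2 (subst2 f G) H"])
  show "lincont (\<lambda>f. subst2 (subst2 f G) H)"
    by (simp add: lincont_def ordge_subst2)
next
  fix i j
  show "subst2 (subst2 (Z1 ^ i * Z2 ^ j) G) H = subst2 (Z1 ^ i * Z2 ^ j) (comp2 G H)"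
    using assms by (simp add: subst2_monom subst2_mult subst2_power) (simp add: comp2_def)
qed (rule lincont_subst2)

lemma zero_const_id [simp]: "zero_const (Z1, Z2)"
  by (simp add: zero_const_def)

lemma subst2_id [simp]: "subst2 f (Z1, Z2) = f"
  by (rule lincont_ext[OF lincont_subst2, of "\<lambda>f. f"]) (simp_all add: lincont_def subst2_monom)

lemma comp2_assoc:
  "zero_const G \<Longrightarrow> zero_const H \<Longrightarrow> comp2 (comp2 F G) H = comp2 F (comp2 G H)"
  by (simp add: comp2_def subst2_comp2)

lemma comp2_id [simp]: "zero_const F \<Longrightarrow> comp2 (Z1, Z2) F = F" "comp2 F (Z1, Z2) = F"
  by (simp_all add: comp2_def)

lemma triangle_1: "{(i, j). i + j \<le> Suc 0} = {(0, 0), (1, 0), (0, 1)}"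
  by auto

lemma coeff2_subst2_00 [simp]: "coeff2 (subst2 f G) 0 0 = coeff2 f 0 0"
  by (simp add: coeff2_subst2)

lemma coeff2_subst2_10 [simp]: "coeff2 (subst2 f G) (Suc 0) 0 =
    coeff2 f (Suc 0) 0 * coeff2 (fst G) (Suc 0) 0 + coeff2 f 0 (Suc 0) * coeff2 (snd G) (Suc 0) 0"
  by (simp add: coeff2_subst2 triangle_1)

lemma coeff2_subst2_01 [simp]: "coeff2 (subst2 f G) 0 (Suc 0) =
    coeff2 f (Suc 0) 0 * coeff2 (fst G) 0 (Suc 0) + coeff2 f 0 (Suc 0) * coeff2 (snd G) 0 (Suc 0)"
  by (simp add: coeff2_subst2 triangle_1)

section \<open>Perturbation estimates for substitution\<close>

text \<open>Telescoping: one of the \<open>i + j\<close> factors of order 1 gives way to a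
  difference of order \<open>k\<close>. For \<open>i + j = 0\<close> the difference is 0, so the
  truncated subtraction is harmless.\<close>

lemma ordge_monom_diff:
  assumes G: "zero_const G" "zero_const G'"
    and k: "ordge k (fst G - fst G')" "ordge k (snd G - snd G')"
  shows "ordge (i + j - 1 + k) (fst G ^ i * snd G ^ j - fst G' ^ i * snd G' ^ j)"
proof -
  have pow: "ordge (i - 1 + k) (f ^ i - g ^ i)"
    if fg: "ordge 1 f" "ordge 1 g" "ordge k (f - g)" for f g i
  proof (cases i)
    case (Suc m)
    have "ordge (m + k) (f ^ Suc m - g ^ Suc m)" for m
    proof (induction m)
      case (Suc m)
      have "f ^ Suc (Suc m) - g ^ Suc (Suc m) = f * (f ^ Suc m - g ^ Suc m) + (f - g) * g ^ Suc m"
        by (simp add: algebra_simps)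
      moreover have "ordge (1 + (m + k)) (f * (f ^ Suc m - g ^ Suc m))"
        by (intro ordge_mult fg Suc)
      moreover have "ordge (k + Suc m) ((f - g) * g ^ Suc m)"
        by (intro ordge_mult fg ordge_power)
      ultimately show ?case
        by (simp add: ordge_add add.commute)
    qed (use fg in simp)
    then show ?thesis using Suc by simp
  qed (auto simp: ordge_def)
  have z: "ordge 1 (fst G)" "ordge 1 (fst G')" "ordge 1 (snd G)" "ordge 1 (snd G')"
    using G by (auto simp: zero_const_def)
  have eq: "fst G ^ i * snd G ^ j - fst G' ^ i * snd G' ^ j =
      fst G ^ i * (snd G ^ j - snd G' ^ j) + (fst G ^ i - fst G' ^ i) * snd G' ^ j"
    by (simp add: algebra_simps)
  have "ordge (i + (j - 1 + k)) (fst G ^ i * (snd G ^ j - snd G' ^ j))"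
       "ordge ((i - 1 + k) + j) ((fst G ^ i - fst G' ^ i) * snd G' ^ j)"
    by (intro ordge_mult ordge_power pow z k)+
  then have "ordge (i + j - 1 + k) (fst G ^ i * (snd G ^ j - snd G' ^ j))"
       "ordge (i + j - 1 + k) ((fst G ^ i - fst G' ^ i) * snd G' ^ j)"
    by (auto elim!: ordge_mono)
  then show ?thesis unfolding eq by (rule ordge_add)
qed

lemma ordge_subst2_diff:
  assumes "zero_const G" "zero_const G'"
    and "ordge k (fst G - fst G')" "ordge k (snd G - snd G')" and f: "ordge (Suc n) f"
  shows "ordge (n + k) (subst2 f G - subst2 f G')"
  unfolding ordge_def
proof (intro allI impI)
  fix a b assume ab: "a + b < n + k"
  have "coeff2 f i j * coeff2 (fst G ^ i * snd G ^ j - fst G' ^ i * snd G' ^ j) a b = 0" for i j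
  proof (cases "i + j < Suc n")
    case False
    then have "a + b < i + j - 1 + k" using ab by linarith
    then show ?thesis using ordge_monom_diff[OF assms(1-4), of i j] by (simp add: ordge_def)
  qed (use f in \<open>simp add: ordge_def\<close>)
  then show "coeff2 (subst2 f G - subst2 f G') a b = 0"
    unfolding coeff2_diff coeff2_subst2 sum_subtractf[symmetric]
    by (intro sum.neutral) (auto simp: algebra_simps)
qed

lemma ordge_2_iff: "ordge 2 f \<longleftrightarrow> coeff2 f 0 0 = 0 \<and> coeff2 f (Suc 0) 0 = 0 \<and> coeff2 f 0 (Suc 0) = 0"
proof -
  have "i + j < 2 \<longleftrightarrow> (i = 0 \<and> j = 0) \<or> (i = 1 \<and> j = 0) \<or> (i = 0 \<and> j = 1)" for i j :: nat by auto
  then show ?thesis by (auto simp: ordge_def)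
qed

lemma ordge_2_decomp:
  "ordge 2 (f - (C2 (coeff2 f 0 0) + (C2 (coeff2 f 1 0) * Z1 + C2 (coeff2 f 0 1) * Z2)))"
  by (simp add: ordge_2_iff coeff2_C2)

text \<open>The linearisation of substitution: to leading order only the linear parts
  \<open>(a, b)\<close> of \<open>f'\<close> and \<open>M\<close> of \<open>G'\<close> enter.\<close>

lemma subst2_perturb:
  assumes n: "2 \<le> n" and z: "zero_const G" "zero_const G'" "zero_const M"
    and f: "ordge n (f - f')"
    and G: "ordge n (fst G - fst G')" "ordge n (snd G - snd G')"
    and M: "ordge 2 (fst G' - fst M)" "ordge 2 (snd G' - snd M)"
    and ab: "coeff2 f' 1 0 = a" "coeff2 f' 0 1 = b"
    and ij: "i + j \<le> n"
  shows "coeff2 (subst2 f G) i j - coeff2 (subst2 f' G') i j = coeff2 (subst2 (f - f') M) i j +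
      a * (coeff2 (fst G) i j - coeff2 (fst G') i j) + b * (coeff2 (snd G) i j - coeff2 (snd G') i j)"
proof -
  have "ordge 2 (fst G - fst M)" "ordge 2 (snd G - snd M)"
    using ordge_add[OF ordge_mono[OF G(1) n] M(1)] ordge_add[OF ordge_mono[OF G(2) n] M(2)]
    by simp_all
  \<comment> \<open>As \<open>f - f'\<close> has order \<open>n\<close>, replacing \<open>G\<close>
    by \<open>M\<close> in it has an effect only from degree \<open>n + 1\<close> on.\<close>
  then have 1: "ordge (n - 1 + 2) (subst2 (f - f') G - subst2 (f - f') M)"
    using z f n by (intro ordge_subst2_diff) auto
  \<comment> \<open>What \<open>f'\<close> has beyond its constant and linear terms is of order 2,
    so up to degree \<open>n\<close> it does not notice the change from \<open>G'\<close> to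
    \<open>G\<close>.\<close>
  define r where "r = f' - (C2 (coeff2 f' 0 0) + (C2 a * Z1 + C2 b * Z2))"
  have r: "ordge (Suc 1) r" using ordge_2_decomp[of f'] ab by (simp add: r_def numeral_2_eq_2)
  have 2: "ordge (1 + n) (subst2 r G - subst2 r G')"
    using z r G by (intro ordge_subst2_diff)
  have f': "f' = C2 (coeff2 f' 0 0) + (C2 a * Z1 + C2 b * Z2) + r" by (simp add: r_def)
  have "subst2 f' G - subst2 f' G' =
      C2 a * (fst G - fst G') + C2 b * (snd G - snd G') + (subst2 r G - subst2 r G')"
    using z by (subst (1 2) f') (simp add: right_diff_distrib)
  then have "coeff2 (subst2 f' G - subst2 f' G') i j = coeff2 (C2 a * (fst G - fst G') +
      C2 b * (snd G - snd G') + (subst2 r G - subst2 r G')) i j"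
    by simp
  moreover have "coeff2 (subst2 r G - subst2 r G') i j = 0"
    using 2 ij by (simp only: ordge_def)
  ultimately have "coeff2 (subst2 f' G) i j - coeff2 (subst2 f' G') i j =
      a * (coeff2 (fst G) i j - coeff2 (fst G') i j) + b * (coeff2 (snd G) i j - coeff2 (snd G') i j)"
    by simp
  moreover have "coeff2 (subst2 (f - f') G) i j = coeff2 (subst2 (f - f') M) i j"
    using 1 ij n by (simp add: ordge_def)
  ultimately show ?thesis
    unfolding subst2_diff coeff2_diff by algebra
qed

section \<open>The group of formal maps\<close>

text \<open>Well-founded recursion along \<open>d\<close>. It serves both degree-by-degree
  constructions: inverting a tangent map and solving the conjugacy equation.\<close>

lemma graded_fixpoint:
  fixes \<Phi> :: "('i \<Rightarrow> 'b) \<Rightarrow> 'i \<Rightarrow> 'b" and d :: "'i \<Rightarrow> nat"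
  assumes "\<And>x y i. (\<And>j. d j < d i \<Longrightarrow> x j = y j) \<Longrightarrow> \<Phi> x i = \<Phi> y i"
  shows "\<exists>x. \<Phi> x = x"
proof -
  have "adm_wf (measure d) \<Phi>"
    unfolding adm_wf_def by (intro allI impI assms) simp
  then have "wfrec (measure d) \<Phi> = \<Phi> (wfrec (measure d) \<Phi>)"
    by (intro wfrec_fixpoint) simp_all
  then have "\<Phi> (wfrec (measure d) \<Phi>) = wfrec (measure d) \<Phi>" by (rule sym)
  then show ?thesis by - (rule exI)
qed

lemma tangent_subst2_surj:
  assumes "zero_const T" "ordge 2 (fst T - Z1)" "ordge 2 (snd T - Z2)"
  shows "\<exists>g. subst2 g T = f"
proof -
  \<comment> \<open>At a fixed point the residual is 0. As \<open>T\<close> is tangent to the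
    identity, substituting it keeps the leading coefficients of a difference, so the new value at
    \<open>(i, j)\<close> depends on lower degrees only.\<close>
  define \<Phi> where "\<Phi> x = (\<lambda>(i, j). x (i, j) + coeff2 (f - subst2 (Abs2 (curry x)) T) i j)"
    for x :: "nat \<times> nat \<Rightarrow> complex"
  have "\<exists>x. \<Phi> x = x"
  proof (rule graded_fixpoint[where d = "\<lambda>(i, j). i + j"])
    fix x y :: "nat \<times> nat \<Rightarrow> complex" and p :: "nat \<times> nat"
    assume *: "\<And>q. (case q of (i, j) \<Rightarrow> i + j) < (case p of (i, j) \<Rightarrow> i + j) \<Longrightarrow> x q = y q"
    obtain i j where p: "p = (i, j)" by fastforce
    define D where "D = Abs2 (curry x) - Abs2 (curry y)"
    have D: "ordge (i + j) D"
      using * unfolding D_def p ordge_def by auto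
    have "coeff2 (subst2 D T - subst2 D (Z1, Z2)) i j = 0"
    proof (cases "i + j")
      case (Suc m)
      then have "ordge (m + 2) (subst2 D T - subst2 D (Z1, Z2))"
        using D assms by (intro ordge_subst2_diff) auto
      then show ?thesis
        using Suc unfolding ordge_def by simp
    qed auto
    then have "coeff2 (subst2 D T) i j = coeff2 D i j" by simp
    then show "\<Phi> x p = \<Phi> y p"
      by (simp add: \<Phi>_def p D_def) (simp add: algebra_simps)
  qed
  then obtain x where "\<Phi> x = x" ..
  then have x: "\<Phi> x (i, j) = x (i, j)" for i j by simp
  then have "f = subst2 (Abs2 (curry x)) T"
    by (intro coeff2_ext) (simp add: \<Phi>_def)
  then show ?thesis by metis
qed

definition Lin :: "complex \<Rightarrow> complex \<Rightarrow> complex \<Rightarrow> complex \<Rightarrow> fps2 \<times> fps2" where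
  "Lin a b c d = (C2 a * Z1 + C2 b * Z2, C2 c * Z1 + C2 d * Z2)"

lemma zero_const_iff: "zero_const F \<longleftrightarrow> coeff2 (fst F) 0 0 = 0 \<and> coeff2 (snd F) 0 0 = 0"
  unfolding zero_const_def ordge_1_iff ..

lemma coeff2_00_zero_const:
  "zero_const F \<Longrightarrow> coeff2 (fst F) 0 0 = 0" "zero_const F \<Longrightarrow> coeff2 (snd F) 0 0 = 0"
  by (simp_all add: zero_const_iff)

lemma det_linear_part: "det (linear_part F) =
    coeff2 (fst F) 1 0 * coeff2 (snd F) 0 1 - coeff2 (fst F) 0 1 * coeff2 (snd F) 1 0"
  by (simp add: det_2 linear_part_def)

lemma det_linear_part_comp2:
  "det (linear_part (comp2 F G)) = det (linear_part F) * det (linear_part G)"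
  by (simp add: det_linear_part comp2_def algebra_simps)

lemma carrier_G2: "F \<in> carrier G2 \<longleftrightarrow> zero_const F \<and> det (linear_part F) \<noteq> 0"
  by (simp add: G2_def zero_const_iff invertible_det_nz)

lemma mult_G2 [simp]: "F \<otimes>\<^bsub>G2\<^esub> G = comp2 F G"
  and one_G2 [simp]: "\<one>\<^bsub>G2\<^esub> = (Z1, Z2)"
  by (simp_all add: G2_def)

lemma zero_const_Lin [simp]: "zero_const (Lin a b c d)"
  by (simp add: zero_const_def Lin_def ordge_def)

lemma det_Lin [simp]: "det (linear_part (Lin a b c d)) = a * d - b * c"
  by (simp add: det_linear_part Lin_def)

lemma comp2_Lin: "zero_const F \<Longrightarrow> comp2 (Lin a b c d) F =
    (C2 a * fst F + C2 b * snd F, C2 c * fst F + C2 d * snd F)"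
  by (simp add: comp2_def Lin_def)

lemma comp2_Lin_Lin:
  "comp2 (Lin a b c d) (Lin a' b' c' d') =
     Lin (a * a' + b * c') (a * b' + b * d') (c * a' + d * c') (c * b' + d * d')"
  by (simp add: comp2_Lin) (auto simp: Lin_def intro!: coeff2_ext)

lemma Lin_id: "Lin 1 0 0 1 = (Z1, Z2)"
  by (auto simp: Lin_def intro!: coeff2_ext)

text \<open>Composing with the inverse \<open>L\<close> of the linear part makes \<open>F\<close>
  tangent to the identity, where \<open>tangent_subst2_surj\<close> applies.\<close>

lemma G2_left_inverse:
  assumes "F \<in> carrier G2"
  shows "\<exists>G \<in> carrier G2. comp2 G F = (Z1, Z2)"
proof -
  let ?a = "coeff2 (fst F) 1 0" and ?b = "coeff2 (fst F) 0 1"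
    and ?c = "coeff2 (snd F) 1 0" and ?d = "coeff2 (snd F) 0 1"
  have z: "zero_const F" and nz: "?a * ?d - ?b * ?c \<noteq> 0"
    using assms by (simp_all add: carrier_G2 det_linear_part)
  define \<delta> where "\<delta> = ?a * ?d - ?b * ?c"
  define L where "L = Lin (?d / \<delta>) (- ?b / \<delta>) (- ?c / \<delta>) (?a / \<delta>)"
  define T where "T = comp2 L F"
  have T: "zero_const T" by (simp add: T_def L_def)
  have "?d * ?a / \<delta> - ?b * ?c / \<delta> = 1" "?a * ?d / \<delta> - ?c * ?b / \<delta> = 1"
    using nz unfolding \<delta>_def diff_divide_distrib[symmetric] by (simp_all add: mult.commute)
  then have "ordge 2 (fst T - Z1)" "ordge 2 (snd T - Z2)"
    using z by (simp_all add: coeff2_00_zero_const ordge_2_iff T_def L_def comp2_Lin)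
  then obtain g1 g2 where "subst2 g1 T = Z1" "subst2 g2 T = Z2"
    using tangent_subst2_surj[OF T] by meson
  then have g: "comp2 (g1, g2) T = (Z1, Z2)" by (simp add: comp2_def)
  have gz: "zero_const (g1, g2)"
    using arg_cong[OF g, of "\<lambda>F. coeff2 (fst F) 0 0"] arg_cong[OF g, of "\<lambda>F. coeff2 (snd F) 0 0"]
    by (simp add: comp2_def zero_const_def ordge_def)
  have eq: "comp2 (comp2 (g1, g2) L) F = (Z1, Z2)"
    using z g by (simp add: comp2_assoc T_def L_def)
  have "det (linear_part (comp2 (g1, g2) L)) * det (linear_part F) = 1"
    using arg_cong[OF eq, of "\<lambda>F. det (linear_part F)"]
    by (simp only: det_linear_part_comp2) (simp add: det_linear_part)
  then have "comp2 (g1, g2) L \<in> carrier G2"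
    using gz by (auto simp: carrier_G2)
  then show ?thesis using eq by blast
qed

lemma group_G2: "group G2"
  by (rule groupI)
     (use G2_left_inverse in \<open>auto simp: carrier_G2 det_linear_part_comp2 comp2_assoc\<close>,
      simp add: det_linear_part)

section \<open>Reversible elements of a group\<close>

context group
begin

lemma reversible_iff:
  "reversible G g \<longleftrightarrow> g \<in> carrier G \<and> (\<exists>h \<in> carrier G. g \<otimes> h \<otimes> g = h)"
proof -
  have "inv h \<otimes> g \<otimes> h = inv g \<longleftrightarrow> g \<otimes> h \<otimes> g = h"
    if "g \<in> carrier G" "h \<in> carrier G" for g h
  proof -
    have "inv h \<otimes> g \<otimes> h = inv g \<longleftrightarrow> inv h \<otimes> (g \<otimes> h \<otimes> g) = \<one>"
      using that by (metis inv_closed inv_equality l_inv m_assoc m_closed)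
    also have "\<dots> \<longleftrightarrow> g \<otimes> h \<otimes> g = h"
      using that by (metis inv_closed inv_equality inv_inv l_inv m_closed)
    finally show ?thesis .
  qed
  then show ?thesis by (auto simp: reversible_def)
qed

lemma reversible_conj:
  assumes "reversible G g" "t \<in> carrier G"
  shows "reversible G (inv t \<otimes> g \<otimes> t)"
proof -
  obtain h where h: "h \<in> carrier G" "g \<otimes> h \<otimes> g = h" and g: "g \<in> carrier G"
    using assms(1) unfolding reversible_iff by blast
  have "t \<otimes> (inv t \<otimes> x) = x" if "x \<in> carrier G" for x
    using that assms(2) by (simp flip: m_assoc)
  then have "inv t \<otimes> g \<otimes> t \<otimes> (inv t \<otimes> h \<otimes> t) \<otimes> (inv t \<otimes> g \<otimes> t) = inv t \<otimes> (g \<otimes> h \<otimes> g) \<otimes> t"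
    using g h(1) assms(2) by (simp add: m_assoc)
  then show ?thesis
    using g h assms(2) unfolding reversible_iff by auto
qed

text \<open>Conjugation by \<open>H\<close> exchanges \<open>q\<close> and \<open>p = H q H\<close>,
  hence turns \<open>q p^-1\<close> into its inverse \<open>p q^-1\<close>.\<close>

lemma reversible_involution_left:
  assumes H: "H \<in> carrier G" "H \<otimes> H = \<one>" and q: "q \<in> carrier G"
  shows "reversible G (q \<otimes> inv (H \<otimes> q \<otimes> H))"
proof -
  define p where "p = H \<otimes> q \<otimes> H"
  have p: "p \<in> carrier G" using H q by (simp add: p_def)
  have "H \<otimes> q = p \<otimes> H" using H q by (simp add: p_def m_assoc)
  then have "inv p \<otimes> H \<otimes> q = H"
    using H(1) p q by (simp add: m_assoc inv_solve_left')
  moreover have "q \<otimes> H = H \<otimes> p"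
    using H q by (simp add: p_def flip: m_assoc)
  ultimately have "q \<otimes> inv p \<otimes> H \<otimes> (q \<otimes> inv p) = H"
    using H(1) p q by (simp add: m_assoc) (metis inv_closed m_assoc m_closed r_inv r_one)
  then show ?thesis
    using H(1) p q unfolding reversible_iff p_def[symmetric] by blast
qed

text \<open>This is the conjugate by \<open>q\<close> of the element in
  \<open>reversible_involution_left\<close>.\<close>

lemma reversible_involution_right:
  assumes H: "H \<in> carrier G" "H \<otimes> H = \<one>" and q: "q \<in> carrier G"
  shows "reversible G (inv (H \<otimes> q \<otimes> H) \<otimes> q)"
proof -
  have "inv q \<otimes> (q \<otimes> inv (H \<otimes> q \<otimes> H)) \<otimes> q = inv (H \<otimes> q \<otimes> H) \<otimes> q"
    using H(1) q by (simp flip: m_assoc)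
  then show ?thesis
    using reversible_conj[OF reversible_involution_left[OF H q] q] by simp
qed

text \<open>\<open>eq\<close> is free of inverses, so it can be treated as an equation between power
  series. Solved for \<open>F\<close>, it gives a conjugate of \<open>inv P \<otimes> Q\<close>
  times \<open>q \<otimes> inv p\<close>.\<close>

lemma product_of_two_reversibles:
  assumes S: "S \<in> carrier G" "S \<otimes> S = \<one>" and H: "H \<in> carrier G" "H \<otimes> H = \<one>"
    and c: "T \<in> carrier G" "Q \<in> carrier G" "q \<in> carrier G" "F \<in> carrier G"
    and eq: "(S \<otimes> Q \<otimes> S) \<otimes> (T \<otimes> (F \<otimes> (H \<otimes> q \<otimes> H))) = Q \<otimes> (T \<otimes> q)"
  shows "\<exists>r1 r2. reversible G r1 \<and> reversible G r2 \<and> F = r1 \<otimes> r2"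
proof -
  define P p where "P = S \<otimes> Q \<otimes> S" and "p = H \<otimes> q \<otimes> H"
  have Pp: "P \<in> carrier G" "p \<in> carrier G" using S H c by (simp_all add: P_def p_def)
  have "P \<otimes> (T \<otimes> (F \<otimes> p)) = Q \<otimes> (T \<otimes> q)" using eq by (simp add: P_def p_def)
  then have "F \<otimes> p = inv T \<otimes> (inv P \<otimes> (Q \<otimes> (T \<otimes> q)))"
    using Pp c by (metis inv_solve_left m_closed)
  then have "F = inv T \<otimes> (inv P \<otimes> (Q \<otimes> (T \<otimes> q))) \<otimes> inv p"
    using Pp c by (metis inv_closed inv_solve_right m_closed)
  then have "F = (inv T \<otimes> (inv P \<otimes> Q) \<otimes> T) \<otimes> (q \<otimes> inv p)"
    using Pp c by (simp add: m_assoc)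
  moreover have "reversible G (inv T \<otimes> (inv P \<otimes> Q) \<otimes> T)"
    unfolding P_def by (intro reversible_conj reversible_involution_right S c)
  moreover have "reversible G (q \<otimes> inv p)"
    unfolding p_def by (intro reversible_involution_left H c)
  ultimately show ?thesis by blast
qed

end

section \<open>Linear maps\<close>

lemma Lin_in_carrier: "a * d - b * c \<noteq> 0 \<Longrightarrow> Lin a b c d \<in> carrier G2"
  by (simp add: carrier_G2)

text \<open>The reverser \<open>h\<close> of the given map \<open>g\<close> is always an involution
  of determinant -1 such that \<open>g h\<close> has trace 0. As \<open>g h\<close> has determinant
  -1, Cayley-Hamilton gives \<open>(g h)^2 = 1\<close>, that is, \<open>g h g = h\<close>.\<close>

lemma reversible_Lin:
  assumes det: "a * d - b * c = 1"
  shows "reversible G2 (Lin a b c d)"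
proof -
  have rev: ?thesis
    if "h1 * h4 - h2 * h3 \<noteq> 0"
      and "(a * h1 + b * h3) * a + (a * h2 + b * h4) * c = h1"
      and "(a * h1 + b * h3) * b + (a * h2 + b * h4) * d = h2"
      and "(c * h1 + d * h3) * a + (c * h2 + d * h4) * c = h3"
      and "(c * h1 + d * h3) * b + (c * h2 + d * h4) * d = h4"
    for h1 h2 h3 h4
  proof -
    have "comp2 (comp2 (Lin a b c d) (Lin h1 h2 h3 h4)) (Lin a b c d) = Lin h1 h2 h3 h4"
      using that(2-5) by (simp add: comp2_Lin_Lin)
    then show ?thesis
      using det that(1) Lin_in_carrier unfolding group.reversible_iff[OF group_G2] mult_G2
      by (metis zero_neq_one)
  qed
  consider "b \<noteq> 0" | "c \<noteq> 0" | "b = 0" "c = 0" by blast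
  then show ?thesis
  proof cases
    case 1
    \<comment> \<open>This makes the trace of \<open>g h\<close> vanish. \<open>rev\<close> takes
      its arguments in the order \<open>h1\<close>, \<open>h4\<close>, \<open>h2\<close>,
      \<open>h3\<close>, so \<open>h\<close> has rows (1, 0) and (k, -1).\<close>
    define k where "k = (d - a) / b"
    have "k * b = d - a" using 1 by (simp add: k_def)
    then show ?thesis
      using det by (intro rev[of 1 "-1" 0 k]) (simp, algebra+)
  next
    case 2
    define k where "k = (d - a) / c"
    have "k * c = d - a" using 2 by (simp add: k_def)
    then show ?thesis
      using det by (intro rev[of 1 "-1" k 0]) (simp, algebra+)
  next
    case 3
    then show ?thesis
      using det by (intro rev[of 0 0 1 1]) (simp_all add: mult.commute)
  qed
qed

lemma subst2_diag: "coeff2 (subst2 f (C2 c * Z1, C2 d * Z2)) i j = c ^ i * d ^ j * coeff2 f i j"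
proof -
  have "subst2 f (C2 c * Z1, C2 d * Z2) = Abs2 (\<lambda>i j. c ^ i * d ^ j * coeff2 f i j)"
  proof (rule lincont_ext[OF lincont_subst2, of "\<lambda>f. Abs2 (\<lambda>i j. c ^ i * d ^ j * coeff2 f i j)"])
    show "lincont (\<lambda>f. Abs2 (\<lambda>i j. c ^ i * d ^ j * coeff2 f i j))"
      by (auto simp: lincont_def ordge_def distrib_left mult.left_commute intro!: coeff2_ext)
  next
    fix a b
    have "subst2 (Z1 ^ a * Z2 ^ b) (C2 c * Z1, C2 d * Z2) = C2 (c ^ a) * (C2 (d ^ b) * (Z1 ^ a * Z2 ^ b))"
      by (subst subst2_monom) (simp_all add: zero_const_def ordge_def power_mult_distrib C2_power mult_ac)
    then show "subst2 (Z1 ^ a * Z2 ^ b) (C2 c * Z1, C2 d * Z2) =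
        Abs2 (\<lambda>i j. c ^ i * d ^ j * coeff2 (Z1 ^ a * Z2 ^ b) i j)"
      by (auto simp: coeff2_monom intro!: coeff2_ext)
  qed
  then show ?thesis by simp
qed

lemma subst2_antidiag:
  "coeff2 (subst2 f (C2 c * Z2, C2 d * Z1)) i j = c ^ j * d ^ i * coeff2 f j i"
proof -
  have "subst2 f (C2 c * Z2, C2 d * Z1) = Abs2 (\<lambda>i j. c ^ j * d ^ i * coeff2 f j i)"
  proof (rule lincont_ext[OF lincont_subst2, of "\<lambda>f. Abs2 (\<lambda>i j. c ^ j * d ^ i * coeff2 f j i)"])
    show "lincont (\<lambda>f. Abs2 (\<lambda>i j. c ^ j * d ^ i * coeff2 f j i))"
      by (auto simp: lincont_def ordge_def distrib_left mult.left_commute intro!: coeff2_ext)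
  next
    fix a b
    have "subst2 (Z1 ^ a * Z2 ^ b) (C2 c * Z2, C2 d * Z1) = C2 (c ^ a) * (C2 (d ^ b) * (Z1 ^ b * Z2 ^ a))"
      by (subst subst2_monom) (simp_all add: zero_const_def ordge_def power_mult_distrib C2_power mult_ac)
    then show "subst2 (Z1 ^ a * Z2 ^ b) (C2 c * Z2, C2 d * Z1) =
        Abs2 (\<lambda>i j. c ^ j * d ^ i * coeff2 (Z1 ^ a * Z2 ^ b) j i)"
      by (auto simp: coeff2_monom intro!: coeff2_ext)
  qed
  then show ?thesis by simp
qed

section \<open>Solving the conjugacy equation\<close>

lemma subst2_leading_power:
  assumes "ordge m f" "\<And>a b. b \<noteq> 0 \<Longrightarrow> coeff2 f a b = 0" "i + j = m"
  shows "coeff2 (subst2 f G) i j = coeff2 f m 0 * coeff2 (fst G ^ m) i j"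
proof -
  have "coeff2 (subst2 f G) i j =
      (\<Sum>p\<in>{(a, b). a + b \<le> i + j}. if p = (m, 0) then coeff2 f m 0 * coeff2 (fst G ^ m) i j else 0)"
    unfolding coeff2_subst2
  proof (rule sum.cong, rule refl, clarify)
    fix a b assume "a + b \<le> i + j"
    then show "coeff2 f a b * coeff2 (fst G ^ a * snd G ^ b) i j =
        (if (a, b) = (m, 0) then coeff2 f m 0 * coeff2 (fst G ^ m) i j else 0)"
      using assms by (cases "b = 0"; cases "a = m") (auto simp: ordge_def)
  qed
  then show ?thesis using assms(3) by (simp add: finite_triangle)
qed

lemma coeff2_binomial: "i + j = m \<Longrightarrow> coeff2 ((Z1 + Z2) ^ m) i j = of_nat (m choose i)"
proof (induction m arbitrary: i j)
  case (Suc m)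
  show ?case
  proof (cases i)
    case 0
    then show ?thesis using Suc by (simp add: distrib_right)
  next
    case (Suc k)
    then have "coeff2 ((Z1 + Z2) ^ m) k j = of_nat (m choose k)"
      using Suc.prems by (intro Suc.IH) simp
    moreover have "coeff2 ((Z1 + Z2) ^ m) (Suc k) (j - 1) = of_nat (m choose Suc k)" if "j \<noteq> 0"
      using Suc Suc.prems that by (intro Suc.IH) simp
    moreover have "m choose Suc k = 0" if "j = 0"
      using Suc Suc.prems that by simp
    ultimately show ?thesis using Suc by (simp add: distrib_right)
  qed
qed simp

lemma subst2_even:
  assumes "\<And>a b. b \<noteq> 0 \<or> odd a \<Longrightarrow> coeff2 f a b = 0"
  shows "subst2 f (- u, v) = subst2 f (u, w)"
proof (rule coeff2_ext)
  fix i j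
  have *: "coeff2 f a b * coeff2 ((- u) ^ a * v ^ b) i j = coeff2 f a b * coeff2 (u ^ a * w ^ b) i j" for a b
    using assms[of b a] by (cases "b = 0"; cases "even a") auto
  show "coeff2 (subst2 f (- u, v)) i j = coeff2 (subst2 f (u, w)) i j"
    unfolding coeff2_subst2 fst_conv snd_conv * ..
qed

lemma ordge_subst2_perturb:
  assumes "zero_const G" "zero_const G'" "ordge n (f - f')" "ordge 1 f'"
    and "ordge n (fst G - fst G')" "ordge n (snd G - snd G')"
  shows "ordge n (subst2 f G - subst2 f' G')"
proof -
  have "ordge n (subst2 (f - f') G)" using assms by (intro ordge_subst2)
  moreover have "ordge (0 + n) (subst2 f' G - subst2 f' G')"
    using assms by (intro ordge_subst2_diff) auto
  ultimately have "ordge n (subst2 (f - f') G + (subst2 f' G - subst2 f' G'))"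
    by (intro ordge_add) auto
  then show ?thesis by simp
qed

text \<open>All unknown coefficients are collected in one family, indexed by component (\<open>False\<close> for the
  first) and exponents.  The resonant places \<open>(False, m + 1, m)\<close> hold the coefficients of \<open>Q\<close>, the
  resonant places \<open>(True, m, m + 1)\<close> those of the shear, and all other places those of \<open>T\<close>.\<close>

type_synonym unknowns = "bool \<times> nat \<times> nat \<Rightarrow> complex"

definition nonres1 :: "unknowns \<Rightarrow> fps2" where
  "nonres1 x = Abs2 (\<lambda>i j. if 2 \<le> i + j \<and> i \<noteq> Suc j then x (False, i, j) else 0)"

definition nonres2 :: "unknowns \<Rightarrow> fps2" where
  "nonres2 x = Abs2 (\<lambda>i j. if 2 \<le> i + j \<and> j \<noteq> Suc i then x (True, i, j) else 0)"

definition res1 :: "unknowns \<Rightarrow> fps2" where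
  "res1 x = Abs2 (\<lambda>i j. if 2 \<le> i + j \<and> i = Suc j then x (False, i, j) else 0)"

text \<open>The series with the shear coefficient s_m at \<open>Z1 ^ (2 * m)\<close>. Even exponents
  make it invariant under a change of sign of \<open>Z1\<close>.\<close>

definition res2 :: "unknowns \<Rightarrow> fps2" where
  "res2 x = Abs2 (\<lambda>i j. if 2 \<le> i \<and> even i \<and> j = 0 then x (True, i div 2, Suc (i div 2)) else 0)"

definition shear :: "unknowns \<Rightarrow> fps2" where
  "shear x = Z1 * subst2 (res2 x) (Z1 + Z2, Z2)"

definition T\<^sub>1 :: "unknowns \<Rightarrow> fps2" where "T\<^sub>1 x = Z1 + nonres1 x"
definition T\<^sub>2 :: "unknowns \<Rightarrow> fps2" where "T\<^sub>2 x = Z2 + nonres2 x"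
definition Q\<^sub>1 :: "unknowns \<Rightarrow> fps2" where "Q\<^sub>1 x = C2 2 * Z1 + res1 x"

text \<open>The inner map is \<open>H q H\<close>, since conjugation by \<open>H\<close> negates the
  shear.\<close>

definition K :: "fps2 \<times> fps2 \<Rightarrow> unknowns \<Rightarrow> fps2 \<times> fps2" where
  "K F x = comp2 F (Z1, Z2 - shear x)"

text \<open>\<open>E\<^sub>1\<close> and \<open>E\<^sub>2\<close> are the components of \<open>(S Q S) T F (H q H) - Q T q\<close> for \<open>Q = (Q\<^sub>1, z\<^sub>2)\<close>,
  \<open>q = (z\<^sub>1, z\<^sub>2 + shear)\<close>, the swap \<open>S\<close> and \<open>H = (z\<^sub>1, - 2 z\<^sub>1 - z\<^sub>2)\<close>.\<close>

definition E\<^sub>1 :: "fps2 \<times> fps2 \<Rightarrow> unknowns \<Rightarrow> fps2" where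
  "E\<^sub>1 F x = subst2 (T\<^sub>1 x) (K F x) - subst2 (Q\<^sub>1 x) (comp2 (T\<^sub>1 x, T\<^sub>2 x) (Z1, Z2 + shear x))"

definition E\<^sub>2 :: "fps2 \<times> fps2 \<Rightarrow> unknowns \<Rightarrow> fps2" where
  "E\<^sub>2 F x = subst2 (Q\<^sub>1 x) (subst2 (T\<^sub>2 x) (K F x), subst2 (T\<^sub>1 x) (K F x)) -
     subst2 (T\<^sub>2 x) (Z1, Z2 + shear x)"

section \<open>Differences in the leading degree\<close>

lemma ordge_2_unknowns: "ordge 2 (nonres1 x)" "ordge 2 (nonres2 x)" "ordge 2 (res1 x)" "ordge 2 (res2 x)"
  by (auto simp: ordge_def nonres1_def nonres2_def res1_def res2_def)

lemma ordge_3_shear: "ordge 3 (shear x)"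
  using ordge_mult[OF ordge_Z1 ordge_subst2[OF ordge_2_unknowns(4)]] by (simp add: shear_def numeral_3_eq_3)

lemma ordge_2_shear: "ordge 2 (shear x)"
  using ordge_3_shear by (rule ordge_mono) simp

lemma coeff2_ordge: "ordge n f \<Longrightarrow> i + j < n \<Longrightarrow> coeff2 f i j = 0"
  by (simp add: ordge_def)

lemmas small_coeffs [simp] =
  ordge_2_unknowns[THEN iffD1[OF ordge_2_iff], THEN conjunct1]
  ordge_2_unknowns[THEN iffD1[OF ordge_2_iff], THEN conjunct2, THEN conjunct1]
  ordge_2_unknowns[THEN iffD1[OF ordge_2_iff], THEN conjunct2, THEN conjunct2]
  ordge_2_shear[THEN iffD1[OF ordge_2_iff], THEN conjunct1]
  ordge_2_shear[THEN iffD1[OF ordge_2_iff], THEN conjunct2, THEN conjunct1]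
  ordge_2_shear[THEN iffD1[OF ordge_2_iff], THEN conjunct2, THEN conjunct2]

text \<open>In degree \<open>n\<close> the two shears differ by a multiple of
  \<open>Z1 * (Z1 + Z2) ^ (n - 1)\<close>, a term that occurs only if \<open>n - 1\<close> is
  even.\<close>

lemma shear_diff:
  assumes agree: "\<forall>c i j. i + j < n \<longrightarrow> x (c, i, j) = y (c, i, j)" and n: "i + j = n" "2 \<le> n"
  shows "coeff2 (shear x - shear y) i j =
    (if i = 0 \<or> even n then 0
     else (x (True, n div 2, Suc (n div 2)) - y (True, n div 2, Suc (n div 2))) * of_nat ((n - 1) choose (i - 1)))"
proof (cases i)
  case (Suc k)
  have "x (True, a div 2, Suc (a div 2)) = y (True, a div 2, Suc (a div 2))" if "a < n - 1" "even a" for a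
    using that by (intro agree[rule_format]) (auto elim!: evenE)
  then have "ordge (n - 1) (res2 x - res2 y)"
    by (auto simp: ordge_def res2_def)
  then have "coeff2 (subst2 (res2 x - res2 y) (Z1 + Z2, Z2)) k j =
      coeff2 (res2 x - res2 y) (n - 1) 0 * coeff2 (fst (Z1 + Z2, Z2) ^ (n - 1)) k j"
    using n Suc by (intro subst2_leading_power) (auto simp: res2_def)
  also have "\<dots> = coeff2 (res2 x - res2 y) (n - 1) 0 * of_nat ((n - 1) choose k)"
    using n Suc by (simp add: coeff2_binomial)
  finally have "coeff2 (shear x - shear y) i j =
      coeff2 (res2 x - res2 y) (n - 1) 0 * of_nat ((n - 1) choose k)"
    by (simp add: shear_def Suc)
  moreover have "(n - 1) div 2 = n div 2" if "odd n" using that by (auto elim!: oddE)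
  moreover have "2 \<le> n - 1" if "odd n" using that n by presburger
  ultimately show ?thesis
    using n Suc by (auto simp: res2_def)
qed (simp add: shear_def)

text \<open>\<open>subst2_perturb\<close> linearises every composite; the linear parts are diag(2,
  1/2) for \<open>F\<close>, diag(2, 1) for \<open>Q\<close> and the identity for \<open>T\<close>
  and \<open>q\<close>. The shear does not cancel in the second equation: \<open>H q H\<close>
  carries its negative, so the two sides add up to the factor -2.\<close>

lemma E_diff:
  assumes F: "zero_const F" "ordge 2 (fst F - C2 2 * Z1)" "ordge 2 (snd F - C2 (1 / 2) * Z2)"
    and agree: "\<forall>c i j. i + j < n \<longrightarrow> x (c, i, j) = y (c, i, j)" and n: "2 \<le> n"
    and ij: "i + j = n"
  shows "coeff2 (E\<^sub>1 F x) i j - coeff2 (E\<^sub>1 F y) i j =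
      (2 ^ i / 2 ^ j - 2) * coeff2 (nonres1 x - nonres1 y) i j - coeff2 (res1 x - res1 y) i j"
    and "coeff2 (E\<^sub>2 F x) i j - coeff2 (E\<^sub>2 F y) i j =
      2 ^ i / 2 ^ j * coeff2 (res1 x - res1 y) j i +
      (2 * (2 ^ i / 2 ^ j) - 1) * coeff2 (nonres2 x - nonres2 y) i j - 2 * coeff2 (shear x - shear y) i j"
proof -
  let ?q = "\<lambda>x. (Z1, Z2 + shear x)" and ?p = "\<lambda>x. (Z1, Z2 - shear x)"
  let ?D = "(C2 2 * Z1, C2 (1 / 2) * Z2)"
  have i2: "i \<le> n" "j \<le> n" "i + j \<le> n" using ij by auto
  have N: "ordge n (nonres1 x - nonres1 y)" "ordge n (nonres2 x - nonres2 y)" "ordge n (res1 x - res1 y)"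
    using agree by (auto simp: ordge_def nonres1_def nonres2_def res1_def)
  have sh: "ordge n (shear x - shear y)"
    unfolding ordge_def
  proof (intro allI impI)
    fix a b assume ab: "a + b < n"
    show "coeff2 (shear x - shear y) a b = 0"
    proof (cases "2 \<le> a + b")
      case True
      have "a + b < n" "odd (a + b) \<Longrightarrow> (a + b) div 2 + Suc ((a + b) div 2) = a + b"
        using ab by (presburger+)
      then show ?thesis
        using shear_diff[of "a + b" x y a b] True agree by auto
    qed (use coeff2_ordge[OF ordge_2_shear] in auto)
  qed
  have z: "zero_const (?q x)" "zero_const (?p x)" "zero_const (K F x)" "zero_const ?D"
      "zero_const (C2 (1 / 2) * Z2, C2 2 * Z1)"
      "zero_const (comp2 (T\<^sub>1 x, T\<^sub>2 x) G)" "zero_const (T\<^sub>1 x, T\<^sub>2 x)"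
      "zero_const (subst2 (T\<^sub>2 x) G, subst2 (T\<^sub>1 x) G)" for x G
    using F by (simp_all add: zero_const_iff K_def comp2_def T\<^sub>1_def T\<^sub>2_def)
  have F': "coeff2 (fst F) (Suc 0) 0 = 2" "coeff2 (fst F) 0 (Suc 0) = 0"
      "coeff2 (snd F) (Suc 0) 0 = 0" "coeff2 (snd F) 0 (Suc 0) = 1 / 2"
    using F by (simp_all add: ordge_2_iff)
  have l: "ordge 2 (fst (?q x) - fst (Z1, Z2))" "ordge 2 (snd (?q x) - snd (Z1, Z2))"
      "ordge 2 (fst (?p x) - fst (Z1, Z2))" "ordge 2 (snd (?p x) - snd (Z1, Z2))"
      "ordge 2 (fst (K F x) - fst ?D)" "ordge 2 (snd (K F x) - snd ?D)" for x
    using F F' by (simp_all add: coeff2_00_zero_const ordge_2_iff K_def comp2_def)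
  have o: "ordge 1 (fst F)" "ordge 1 (snd F)" "ordge 1 (T\<^sub>1 x)" "ordge 1 (T\<^sub>2 x)" for x
    using F z(7) by (simp_all add: zero_const_def)
  have dp: "ordge n (fst (?p x) - fst (?p y))" "ordge n (snd (?p x) - snd (?p y))"
    and dq: "ordge n (fst (?q x) - fst (?q y))" "ordge n (snd (?q x) - snd (?q y))"
    using sh by (auto simp: ordge_def)
  have dT: "ordge n (T\<^sub>1 x - T\<^sub>1 y)" "ordge n (T\<^sub>2 x - T\<^sub>2 y)" "ordge n (Q\<^sub>1 x - Q\<^sub>1 y)"
    using N by (auto simp: T\<^sub>1_def T\<^sub>2_def Q\<^sub>1_def)
  have dK: "ordge n (fst (K F x) - fst (K F y))" "ordge n (snd (K F x) - snd (K F y))"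
    using ordge_subst2_perturb[OF z(2) z(2) _ o(1) dp] ordge_subst2_perturb[OF z(2) z(2) _ o(2) dp]
    by (simp_all add: K_def comp2_def ordge_def)
  have dTK: "ordge n (subst2 (T\<^sub>1 x) (K F x) - subst2 (T\<^sub>1 y) (K F y))"
      "ordge n (subst2 (T\<^sub>2 x) (K F x) - subst2 (T\<^sub>2 y) (K F y))"
    by (rule ordge_subst2_perturb z o dT dK)+
  have dTq: "ordge n (subst2 (T\<^sub>1 x) (?q x) - subst2 (T\<^sub>1 y) (?q y))"
      "ordge n (subst2 (T\<^sub>2 x) (?q x) - subst2 (T\<^sub>2 y) (?q y))"
    by (rule ordge_subst2_perturb z o dT dq)+
  \<comment> \<open>To leading order, diag(2, 1/2) passes the change of the shear on to the second
    component alone, halved.\<close>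
  have K1: "coeff2 (fst (K F x)) i j - coeff2 (fst (K F y)) i j = 0"
    unfolding K_def comp2_def fst_conv
    using subst2_perturb[OF n z(2) z(2) zero_const_id _ dp l(3,4), of "fst F" "fst F", OF _ refl refl i2(3)]
    by (simp add: F' ordge_def)
  have K2: "coeff2 (snd (K F x)) i j - coeff2 (snd (K F y)) i j = - coeff2 (shear x - shear y) i j / 2"
    unfolding K_def comp2_def snd_conv
    using subst2_perturb[OF n z(2) z(2) zero_const_id _ dp l(3,4), of "snd F" "snd F", OF _ refl refl i2(3)]
    by (simp add: F' ordge_def field_simps)
  have d: "T\<^sub>1 x - T\<^sub>1 y = nonres1 x - nonres1 y" "T\<^sub>2 x - T\<^sub>2 y = nonres2 x - nonres2 y"
      "Q\<^sub>1 x - Q\<^sub>1 y = res1 x - res1 y"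
    by (simp_all add: T\<^sub>1_def T\<^sub>2_def Q\<^sub>1_def)
  have c: "coeff2 (T\<^sub>1 y) 1 0 = 1" "coeff2 (T\<^sub>1 y) 0 1 = 0" "coeff2 (T\<^sub>2 y) 1 0 = 0"
      "coeff2 (T\<^sub>2 y) 0 1 = 1" "coeff2 (Q\<^sub>1 y) 1 0 = 2" "coeff2 (Q\<^sub>1 y) 0 1 = 0"
    by (simp_all add: T\<^sub>1_def T\<^sub>2_def Q\<^sub>1_def)
  have T1K: "coeff2 (subst2 (T\<^sub>1 x) (K F x)) i j - coeff2 (subst2 (T\<^sub>1 y) (K F y)) i j =
      2 ^ i / 2 ^ j * coeff2 (nonres1 x - nonres1 y) i j"
    unfolding subst2_perturb[OF n z(3) z(3) z(4) dT(1) dK l(5,6) c(1,2) i2(3)] d K1 K2 subst2_diag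
    by (simp add: power_one_over)
  have T2K: "coeff2 (subst2 (T\<^sub>2 x) (K F x)) i j - coeff2 (subst2 (T\<^sub>2 y) (K F y)) i j =
      2 ^ i / 2 ^ j * coeff2 (nonres2 x - nonres2 y) i j - coeff2 (shear x - shear y) i j / 2"
    unfolding subst2_perturb[OF n z(3) z(3) z(4) dT(2) dK l(5,6) c(3,4) i2(3)] d K1 K2 subst2_diag
    by (simp add: power_one_over diff_divide_distrib)
  have T1q: "coeff2 (subst2 (T\<^sub>1 x) (?q x)) i j - coeff2 (subst2 (T\<^sub>1 y) (?q y)) i j =
      coeff2 (nonres1 x - nonres1 y) i j"
    using subst2_perturb[OF n z(1) z(1) zero_const_id dT(1) dq l(1,2) refl refl i2(3)]
    by (simp add: T\<^sub>1_def)
  have T2q: "coeff2 (subst2 (T\<^sub>2 x) (?q x)) i j - coeff2 (subst2 (T\<^sub>2 y) (?q y)) i j =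
      coeff2 (nonres2 x - nonres2 y) i j + coeff2 (shear x - shear y) i j"
    using subst2_perturb[OF n z(1) z(1) zero_const_id dT(2) dq l(1,2) refl refl i2(3)]
    by (simp add: T\<^sub>2_def)
  have Tq_lin: "ordge 2 (subst2 (T\<^sub>1 y) (?q y) - Z1)" "ordge 2 (subst2 (T\<^sub>2 y) (?q y) - Z2)"
    by (simp_all add: ordge_2_iff T\<^sub>1_def T\<^sub>2_def del: subst2_add)
  have QTq: "coeff2 (subst2 (Q\<^sub>1 x) (comp2 (T\<^sub>1 x, T\<^sub>2 x) (?q x))) i j -
      coeff2 (subst2 (Q\<^sub>1 y) (comp2 (T\<^sub>1 y, T\<^sub>2 y) (?q y))) i j =
      coeff2 (res1 x - res1 y) i j + 2 * coeff2 (nonres1 x - nonres1 y) i j"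
    using subst2_perturb[OF n z(6)[unfolded comp2_def] z(6)[unfolded comp2_def] zero_const_id dT(3),
        unfolded fst_conv snd_conv, OF dTq Tq_lin refl refl i2(3)] T1q T2q
    by (simp add: Q\<^sub>1_def comp2_def)
  have TK_lin: "ordge 2 (subst2 (T\<^sub>2 y) (K F y) - C2 (1 / 2) * Z2)"
      "ordge 2 (subst2 (T\<^sub>1 y) (K F y) - C2 2 * Z1)"
    using F F' by (simp_all add: coeff2_00_zero_const ordge_2_iff T\<^sub>1_def T\<^sub>2_def K_def comp2_def del: subst2_add)
  \<comment> \<open>The arguments are tangent to \<open>(Z2 / 2, 2 * Z1)\<close>, the variables
    being exchanged by \<open>S\<close>; hence \<open>res1\<close> is read at
    \<open>(j, i)\<close>.\<close>
  have QTK: "coeff2 (subst2 (Q\<^sub>1 x) (subst2 (T\<^sub>2 x) (K F x), subst2 (T\<^sub>1 x) (K F x))) i j -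
      coeff2 (subst2 (Q\<^sub>1 y) (subst2 (T\<^sub>2 y) (K F y), subst2 (T\<^sub>1 y) (K F y))) i j =
      2 ^ i / 2 ^ j * coeff2 (res1 x - res1 y) j i +
      2 * (2 ^ i / 2 ^ j) * coeff2 (nonres2 x - nonres2 y) i j - coeff2 (shear x - shear y) i j"
    unfolding subst2_perturb[OF n z(8) z(8) z(5) dT(3), unfolded fst_conv snd_conv,
        OF dTK(2) dTK(1) TK_lin c(5,6) i2(3)] T1K T2K d subst2_antidiag
    by (simp add: power_one_over diff_divide_distrib algebra_simps)
  define k :: complex where "k = 2 ^ i / 2 ^ j"
  show "coeff2 (E\<^sub>1 F x) i j - coeff2 (E\<^sub>1 F y) i j =
      (2 ^ i / 2 ^ j - 2) * coeff2 (nonres1 x - nonres1 y) i j - coeff2 (res1 x - res1 y) i j"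
    using T1K QTq unfolding E\<^sub>1_def coeff2_diff k_def[symmetric] by algebra
  show "coeff2 (E\<^sub>2 F x) i j - coeff2 (E\<^sub>2 F y) i j =
      2 ^ i / 2 ^ j * coeff2 (res1 x - res1 y) j i +
      (2 * (2 ^ i / 2 ^ j) - 1) * coeff2 (nonres2 x - nonres2 y) i j - 2 * coeff2 (shear x - shear y) i j"
    using QTK T2q unfolding E\<^sub>2_def coeff2_diff k_def[symmetric] by algebra
qed

section \<open>The triangular system for the unknowns\<close>

text \<open>The diagonal of the linear system: the factor of each unknown in the equation at its own
  place, read off from \<open>E_diff\<close> and \<open>shear_diff\<close>.\<close>

definition multiplier :: "bool \<times> nat \<times> nat \<Rightarrow> complex" where
  "multiplier = (\<lambda>(c, i, j).
     if c then if j = Suc i then - 2 * of_nat ((2 * i) choose (i - 1)) else 2 * (2 ^ i / 2 ^ j) - 1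
     else if i = Suc j then - 1 else 2 ^ i / 2 ^ j - 2)"

lemma power_2_eq_iff: "(2 :: complex) ^ i = 2 ^ j \<longleftrightarrow> i = j"
proof -
  have "(2 :: complex) ^ i = of_nat (2 ^ i)" for i by simp
  then show ?thesis by (metis of_nat_eq_iff one_less_numeral_iff power_inject_exp semiring_norm(76))
qed

text \<open>The two factors with \<open>2 ^ i / 2 ^ j\<close> could vanish only at resonant places,
  where other unknowns take over. The binomial coefficient is positive because
  \<open>i - 1 \<le> 2 * i\<close>.\<close>

lemma multiplier_nonzero: "multiplier (c, i, j) \<noteq> 0"
proof (cases c)
  case True
  have "2 * i choose (i - 1) \<noteq> 0" by (simp add: binomial_eq_0_iff)
  moreover have "2 * (2 ^ i / 2 ^ j) \<noteq> (1 :: complex)" if "j \<noteq> Suc i"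
    using power_2_eq_iff[of "Suc i" j] that by simp
  ultimately show ?thesis using True by (simp add: multiplier_def)
next
  case False
  have "2 ^ i / 2 ^ j \<noteq> (2 :: complex)" if "i \<noteq> Suc j"
    using power_2_eq_iff[of i "Suc j"] that by (simp add: divide_eq_eq)
  then show ?thesis using False by (simp add: multiplier_def)
qed

text \<open>Within one degree the second equation at a resonant place involves \<open>Q\<close>, and at the other places
  the shear.\<close>

definition weight :: "bool \<times> nat \<times> nat \<Rightarrow> nat" where
  "weight = (\<lambda>(c, i, j). 3 * (i + j) + (if c then if j = Suc i then 1 else 2 else 0))"

text \<open>Subtracting the residual divided by the multiplier cancels the unknown at the place
  itself, and a fixed point solves the equations from degree 2 on.\<close>

definition step :: "fps2 \<times> fps2 \<Rightarrow> unknowns \<Rightarrow> unknowns" where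
  "step F x = (\<lambda>(c, i, j). if i + j < 2 then 0
     else x (c, i, j) - coeff2 ((if c then E\<^sub>2 else E\<^sub>1) F x) i j / multiplier (c, i, j))"

lemma step_graded:
  assumes F: "zero_const F" "ordge 2 (fst F - C2 2 * Z1)" "ordge 2 (snd F - C2 (1 / 2) * Z2)"
    and agree: "\<And>q. weight q < weight p \<Longrightarrow> x q = y q"
  shows "step F x p = step F y p"
proof -
  obtain c i j where p: "p = (c, i, j)" by (metis prod_cases3)
  show ?thesis
  proof (cases "i + j < 2")
    case False
    define n where "n = i + j"
    have low: "\<forall>d k l. k + l < n \<longrightarrow> x (d, k, l) = y (d, k, l)"
      by (intro allI impI agree) (auto simp: weight_def p n_def)
    have n: "2 \<le> n" using False by (simp add: n_def)
    note E = E_diff[OF F, OF low n n_def[symmetric]]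
    have "coeff2 ((if c then E\<^sub>2 else E\<^sub>1) F x) i j - coeff2 ((if c then E\<^sub>2 else E\<^sub>1) F y) i j =
        multiplier p * (x p - y p)"
    proof (cases c)
      case c: False
      show ?thesis
        using E(1) False by (simp add: c p multiplier_def nonres1_def res1_def)
    next
      case c: True
      \<comment> \<open>Only the unknown at \<open>(False, j, i)\<close> can enter here; it has
        equal degree and smaller weight.\<close>
      have res: "coeff2 (res1 x - res1 y) j i = 0"
        using agree[of "(False, j, i)"] by (auto simp: res1_def weight_def p c)
      show ?thesis
      proof (cases "j = Suc i")
        case True
        \<comment> \<open>The leading shear coefficient is the unknown at \<open>p\<close> itself;
          degree at least 2 excludes \<open>i = 0\<close>.\<close>
        then have "i \<noteq> 0" "n = Suc (2 * i)" using False by (auto simp: n_def)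
        then have "coeff2 (shear x - shear y) i j = (x p - y p) * of_nat ((2 * i) choose (i - 1))"
          unfolding shear_diff[OF low n_def[symmetric] n] by (simp add: p c True)
        then show ?thesis
          unfolding if_P[OF c] E(2) res by (simp add: p c True multiplier_def nonres2_def)
      next
        case j: False
        \<comment> \<open>The leading shear coefficient sits at a resonant place of smaller
          weight.\<close>
        have "x (True, k, Suc k) = y (True, k, Suc k)" if "n = Suc (2 * k)" for k
          using that j by (intro agree) (auto simp: weight_def p c n_def)
        then have "coeff2 (shear x - shear y) i j = 0"
          unfolding shear_diff[OF low n_def[symmetric] n] by (auto elim!: oddE)
        then show ?thesis
          unfolding if_P[OF c] E(2) res using False j by (simp add: p c multiplier_def nonres2_def)
      qed
    qed
    then have "coeff2 ((if c then E\<^sub>2 else E\<^sub>1) F x) i j =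
        coeff2 ((if c then E\<^sub>2 else E\<^sub>1) F y) i j + multiplier p * (x p - y p)"
      by (simp only: diff_eq_eq add.commute)
    then show ?thesis
      using multiplier_nonzero[of c i j] False
      by (simp add: step_def p add_divide_distrib)
  qed (simp add: step_def p)
qed

lemma normal_form:
  assumes F: "zero_const F" "ordge 2 (fst F - C2 2 * Z1)" "ordge 2 (snd F - C2 (1 / 2) * Z2)"
  shows "\<exists>x. E\<^sub>1 F x = 0 \<and> E\<^sub>2 F x = 0"
proof -
  obtain x where x: "step F x = x"
    using graded_fixpoint[of weight "step F"] step_graded[OF F] by blast
  have F': "coeff2 (fst F) (Suc 0) 0 = 2" "coeff2 (fst F) 0 (Suc 0) = 0"
      "coeff2 (snd F) (Suc 0) 0 = 0" "coeff2 (snd F) 0 (Suc 0) = 1 / 2"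
    using F by (simp_all add: ordge_2_iff)
  \<comment> \<open>\<open>step\<close> imposes nothing below degree 2. There the equations hold
    because the linear part diag(1, 2) of \<open>S Q S\<close> times diag(2, 1/2) is diag(2, 1),
    that of \<open>Q\<close>.\<close>
  have low: "ordge 2 (E\<^sub>1 F x)" "ordge 2 (E\<^sub>2 F x)"
    by (simp_all add: ordge_2_iff E\<^sub>1_def E\<^sub>2_def T\<^sub>1_def T\<^sub>2_def Q\<^sub>1_def K_def comp2_def F' F(1)
        coeff2_00_zero_const del: subst2_add)
  have "coeff2 ((if c then E\<^sub>2 else E\<^sub>1) F x) i j = 0" for c i j
  proof (cases "i + j < 2")
    case True
    then show ?thesis using low by (simp add: ordge_def)
  next
    case False
    then have "step F x (c, i, j) =
        x (c, i, j) - coeff2 ((if c then E\<^sub>2 else E\<^sub>1) F x) i j / multiplier (c, i, j)"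
      by (simp add: step_def)
    then show ?thesis using multiplier_nonzero[of c i j] False unfolding x by simp
  qed
  from this[of False] this[of True] show ?thesis
    by (intro exI[of _ x] conjI coeff2_ext) simp_all
qed

text \<open>\<open>H\<close> fixes \<open>Z1\<close> and negates \<open>Z1 + Z2\<close>, of which
  only even powers occur in the second factor.\<close>

lemma shear_invariant: "subst2 (shear x) (Lin 1 0 (-2) (-1)) = shear x"
proof -
  have C2_minus: "C2 (- c) = - C2 c" for c by (simp add: C2_def flip: fps_const_neg)
  have C2_2: "C2 2 = 2" by (simp add: C2_def numeral_fps_const)
  have z: "zero_const (Z1 + Z2, Z2)" by (simp add: zero_const_iff)
  have "subst2 (shear x) (Lin 1 0 (-2) (-1)) =
      Z1 * subst2 (res2 x) (comp2 (Z1 + Z2, Z2) (Lin 1 0 (-2) (-1)))"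
    using z by (simp add: shear_def subst2_mult subst2_comp2) (simp add: Lin_def)
  also have "comp2 (Z1 + Z2, Z2) (Lin 1 0 (-2) (-1)) = (- (Z1 + Z2), snd (Lin 1 0 (-2) (-1)))"
    by (simp add: comp2_def) (simp add: Lin_def C2_minus C2_2)
  also have "subst2 (res2 x) \<dots> = subst2 (res2 x) (Z1 + Z2, Z2)"
    by (intro subst2_even) (auto simp: res2_def)
  finally show ?thesis by (simp add: shear_def)
qed

section \<open>Factorisation\<close>

lemma hyperbolic_product_of_two_reversibles:
  assumes F: "zero_const F" "ordge 2 (fst F - C2 2 * Z1)" "ordge 2 (snd F - C2 (1 / 2) * Z2)"
  shows "\<exists>r1 r2. reversible G2 r1 \<and> reversible G2 r2 \<and> F = comp2 r1 r2"
proof -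
  obtain x where E: "E\<^sub>1 F x = 0" "E\<^sub>2 F x = 0"
    using normal_form[OF F] by blast
  define S H T Q q where "S = Lin 0 1 1 0" and "H = Lin 1 0 (-2) (-1)" and "T = (T\<^sub>1 x, T\<^sub>2 x)"
    and "Q = (Q\<^sub>1 x, Z2)" and "q = (Z1, Z2 + shear x)"
  have SH: "S \<in> carrier G2" "comp2 S S = (Z1, Z2)" "H \<in> carrier G2" "comp2 H H = (Z1, Z2)"
    by (simp_all add: S_def H_def Lin_in_carrier comp2_Lin_Lin Lin_id)
  have c: "T \<in> carrier G2" "Q \<in> carrier G2" "q \<in> carrier G2"
    by (simp_all add: carrier_G2 zero_const_iff det_linear_part T_def Q_def q_def T\<^sub>1_def T\<^sub>2_def Q\<^sub>1_def)
  have z: "zero_const S" "zero_const H" "zero_const T" "zero_const Q" "zero_const q"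
    using SH c by (simp_all add: carrier_G2)
  have "F \<in> carrier G2"
    using F by (auto simp: carrier_G2 det_linear_part ordge_2_iff)
  have S: "S = (Z2, Z1)" by (simp add: S_def Lin_def)
  \<comment> \<open>As the shear is invariant under \<open>H\<close>, the second component is
    \<open>- 2 z1 - (- 2 z1 - z2 + shear)\<close>.\<close>
  have "comp2 (comp2 H q) H = comp2 (Lin 1 0 (-2) (-1)) (comp2 q H)"
    using z by (simp add: comp2_assoc H_def)
  also have "\<dots> = (Z1, Z2 - shear x)"
    unfolding comp2_Lin[OF zero_const_comp2[OF z(5)]]
    using z(2) by (simp add: comp2_def q_def H_def shear_invariant)
       (auto simp: Lin_def intro!: coeff2_ext)
  finally have p: "comp2 (comp2 H q) H = (Z1, Z2 - shear x)" .
  let ?TK = "comp2 T (K F x)"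
  have zTK: "zero_const ?TK" using z by simp
  have SQS: "comp2 (comp2 (comp2 S Q) S) G = (fst G, subst2 (Q\<^sub>1 x) (snd G, fst G))"
    if "zero_const G" for G
  proof -
    have "comp2 (comp2 (comp2 S Q) S) G = comp2 S (comp2 Q (comp2 S G))"
      using that z by (simp add: comp2_assoc)
    also have "comp2 S G = (snd G, fst G)"
      using that by (simp add: S comp2_def)
    also have "zero_const (snd G, fst G)" using that by (simp add: zero_const_iff)
    then have "comp2 S (comp2 Q (snd G, fst G)) = (fst G, subst2 (Q\<^sub>1 x) (snd G, fst G))"
      using z(4) zero_const_comp2[OF z(4), of "(snd G, fst G)"]
      by (simp add: S comp2_def Q_def)
    finally show ?thesis .
  qed
  have "comp2 (comp2 (comp2 S Q) S) ?TK = comp2 Q (comp2 T q)"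
    using E zero_const_comp2[OF z(3), of q] unfolding SQS[OF zTK]
    by (simp add: E\<^sub>1_def E\<^sub>2_def comp2_def T_def Q_def q_def)
  then show ?thesis
    using group.product_of_two_reversibles[OF group_G2, of S H T Q q F] SH c \<open>F \<in> carrier G2\<close>
    by (simp add: p K_def)
qed

lemma det_1_product_of_three_reversibles:
  assumes F: "zero_const F" "det (linear_part F) = 1"
  shows "\<exists>r0 r1 r2. reversible G2 r0 \<and> reversible G2 r1 \<and> reversible G2 r2 \<and>
    F = comp2 r0 (comp2 r1 r2)"
proof -
  define a b c d where "a = coeff2 (fst F) 1 0" and "b = coeff2 (fst F) 0 1"
    and "c = coeff2 (snd F) 1 0" and "d = coeff2 (snd F) 0 1"
  have det: "a * d - b * c = 1"
    using F(2) by (simp add: det_linear_part a_def b_def c_def d_def)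
  \<comment> \<open>If \<open>A\<close> is the linear part of \<open>F\<close>, then
    \<open>L\<close> is \<open>A\<close> diag(1/2, 2), of determinant 1, and \<open>L'\<close> is
    its inverse, so that \<open>L' A\<close> is diag(2, 1/2).\<close>
  define L L' where "L = Lin (a / 2) (2 * b) (c / 2) (2 * d)"
    and "L' = Lin (2 * d) (- 2 * b) (- c / 2) (a / 2)"
  have "reversible G2 L"
    unfolding L_def by (rule reversible_Lin) (use det in simp)
  have "zero_const (comp2 L' F)" by (simp add: L'_def)
  moreover have "ordge 2 (fst (comp2 L' F) - C2 2 * Z1)" "ordge 2 (snd (comp2 L' F) - C2 (1 / 2) * Z2)"
    using F(1) det by (simp_all add: L'_def comp2_Lin ordge_2_iff coeff2_00_zero_const
        flip: a_def b_def c_def d_def One_nat_def) (algebra+)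
  ultimately obtain r1 r2 where r: "reversible G2 r1" "reversible G2 r2" "comp2 L' F = comp2 r1 r2"
    using hyperbolic_product_of_two_reversibles by blast
  have "comp2 L L' = (Z1, Z2)"
    using det by (simp add: L_def L'_def comp2_Lin_Lin mult.commute flip: Lin_id)
  then have "F = comp2 L (comp2 L' F)"
    using F(1) comp2_assoc[of L' F L] by (simp add: L'_def)
  then show ?thesis using r \<open>reversible G2 L\<close> by metis
qed

theorem theorem1p7:
  fixes F :: "fps2 \<times> fps2"
  assumes "F \<in> carrier G2"
    and "det (linear_part F) = 1 \<or> det (linear_part F) = -1"
  shows "\<exists>rs h. length rs \<le> 4 \<and> (\<forall>r \<in> set rs. reversible G2 r) \<and> involution G2 h \<and>
           F = foldr (\<lambda>r p. r \<otimes>\<^bsub>G2\<^esub> p) rs h"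
proof -
  have z: "zero_const F" using assms(1) by (simp add: carrier_G2)
  obtain h where h: "h \<in> carrier G2" "comp2 h h = (Z1, Z2)" "det (linear_part h) = det (linear_part F)"
  proof -
    let ?d = "det (linear_part F)"
    have "?d * ?d = 1" "?d \<noteq> 0" using assms(2) by auto
    then show thesis
      by (intro that[of "Lin 1 0 0 ?d"]) (simp_all add: Lin_in_carrier comp2_Lin_Lin Lin_id)
  qed
  have zh: "zero_const h" using h(1) by (simp add: carrier_G2)
  have "det (linear_part (comp2 F h)) = 1"
    using assms(2) h(3) by (auto simp: det_linear_part_comp2)
  then obtain r0 r1 r2 where r: "reversible G2 r0" "reversible G2 r1" "reversible G2 r2"
      "comp2 F h = comp2 r0 (comp2 r1 r2)"
    using det_1_product_of_three_reversibles[of "comp2 F h"] z by auto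
  have zr: "zero_const r1" "zero_const r2"
    using r by (auto simp: reversible_def carrier_G2)
  have "F = comp2 (comp2 F h) h"
    using z zh h(2) by (simp add: comp2_assoc)
  also have "\<dots> = comp2 r0 (comp2 r1 (comp2 r2 h))"
    using zr zh by (simp add: r(4) comp2_assoc)
  finally have "F = foldr (\<lambda>r p. r \<otimes>\<^bsub>G2\<^esub> p) [r0, r1, r2] h" by simp
  moreover have "involution G2 h" using h by (simp add: involution_def)
  ultimately show ?thesis
    using r(1-3) by (intro exI[of _ "[r0, r1, r2]"] exI[of _ h]) simp
qed

end
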